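(* Let $\mathcal P$ be the category of PERs. Every realizable endofunctor $F:\mathcal P\to\mathcal P$ is naturally isomorphic to a monotone realizable endofunctor $G:\mathcal P\to\mathcal P$, i.e. one such that $R\subseteq S$ implies $GR\subseteq GS$ for all PERs $R,S$.
   Context: A PER (partial equivalence relation) is a subset $R\subseteq\mathbb N^2$ that is symmetric and transitive. Its domain is $\mathrm{dom}R=\{n\mid (n,n)\in R\}$, on which $R$ is an equivalence relation; $[n]_R$ denotes the class of $n\in\mathrm{dom}R$. A morphism $f:R\to S$ of PERs is a function $f:\mathrm{dom}R/R\to\mathrm{dom}S/S$ tracked by a partial recursive function $\phi$, i.e. for all $n\in\mathrm{dom}R$, $\phi(n)$ is defined and $f[n]_R=[\phi(n)]_S$. These form the category $\mathcal P$. Write $nm$ for the application of the $n$-th partial recursive function to $m$, and $[x]_{R\to S}$ for the morphism $R\to S$ tracked by the $x$-th partial recursive function. An endofunctor $F$ of $\mathcal P$ is realizable if there is a single partial recursive function $\phi$ such that for all PERs $R,S$ and all $x$ with $[x]_{R\to S}$ a morphism $R\to S$, $\phi x$ is defined and $F([x]_{R\to S})=[\phi x]_{FR\to FS}$. A realizable endofunctor is monotone if its object map is monotone with respect to inclusion of PERs. *)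

theory Defs
  imports Main "HOL-Library.FuncSet" "HOL-Library.Nat_Bijection"
begin

section \<open>Partial recursive functions and their numbering\<close>

text \<open>Kleene's description of partial recursive functions. \<open>Zero\<close>, \<open>Proj i\<close> and \<open>Mu f\<close>
  make sense at every arity; a term applied to a list of an unsuitable length is undefined.\<close>

datatype recf =
    Zero
  | Succ
  | Proj nat
  | Comp recf "recf list"
  | PrimRec recf recf
  | Mu recf

fun reval :: "recf \<Rightarrow> nat list \<Rightarrow> nat option" where
  "reval Zero xs = Some 0"
| "reval Succ xs = (case xs of [x] \<Rightarrow> Some (Suc x) | _ \<Rightarrow> None)"
| "reval (Proj i) xs = (if i < length xs then Some (xs ! i) else None)"
| "reval (Comp f gs) xs =
    (case those (map (\<lambda>g. reval g xs) gs) of None \<Rightarrow> None | Some ys \<Rightarrow> reval f ys)"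
| "reval (PrimRec f g) xs =
    (case xs of [] \<Rightarrow> None
     | n # ys \<Rightarrow> rec_nat (reval f ys) (\<lambda>k r. Option.bind r (\<lambda>v. reval g (k # v # ys))) n)"
| "reval (Mu f) xs =
    (if \<exists>n. reval f (n # xs) = Some 0 \<and> (\<forall>k<n. \<exists>v>0. reval f (k # xs) = Some v)
     then Some (LEAST n. reval f (n # xs) = Some 0) else None)"

lemma list_decode_mem_less: "x \<in> set (list_decode n) \<Longrightarrow> x < n"
proof (induction n rule: list_decode.induct)
  case (2 n)
  obtain a b where ab: "prod_decode n = (a, b)" by (cases "prod_decode n")
  then have "n = prod_encode (a, b)" by (metis prod_decode_inverse)
  then have "a \<le> n" "b \<le> n" by (simp_all add: le_prod_encode_1 le_prod_encode_2)
  then show ?case using 2 ab by (fastforce dest: less_le_trans)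
qed simp

lemma prod_decode_le: "fst (prod_decode n) \<le> n" "snd (prod_decode n) \<le> n"
  by (metis le_prod_encode_1 prod.collapse prod_decode_inverse)
     (metis le_prod_encode_2 prod.collapse prod_decode_inverse)

text \<open>Goedel numbering of terms: the residue modulo 6 selects the constructor and the quotient
  codes its arguments. Every number is the code of a term.\<close>

function rdecode :: "nat \<Rightarrow> recf" where
  "rdecode n =
    (let k = n div 6; a = fst (prod_decode k); b = snd (prod_decode k) in
     if n mod 6 = 0 then Zero
     else if n mod 6 = 1 then Succ
     else if n mod 6 = 2 then Proj k
     else if n mod 6 = 3 then Comp (rdecode a) (map rdecode (list_decode b))
     else if n mod 6 = 4 then PrimRec (rdecode a) (rdecode b)
     else Mu (rdecode k))"
  by pat_completeness auto
termination
proof -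
  have div_less: "n div 6 < n" if "n mod 6 \<noteq> 0" for n :: nat
    using that by (cases "n = 0") auto
  have fst_less: "fst (prod_decode (n div 6)) < n" if "n mod 6 \<noteq> 0" for n
    using div_less[OF that] prod_decode_le(1) le_less_trans by blast
  have snd_less: "snd (prod_decode (n div 6)) < n" if "n mod 6 \<noteq> 0" for n
    using div_less[OF that] prod_decode_le(2) le_less_trans by blast
  have mem_less: "z < n" if "n mod 6 \<noteq> 0" "z \<in> set (list_decode (snd (prod_decode (n div 6))))" for z n
    using list_decode_mem_less[OF that(2)] snd_less[OF that(1)] by (rule less_trans)
  show ?thesis
    by (relation "measure id") (simp_all add: div_less fst_less snd_less mem_less del: One_nat_def)
qed

declare rdecode.simps [simp del]

primrec rencode :: "recf \<Rightarrow> nat" where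
  "rencode Zero = 0"
| "rencode Succ = 1"
| "rencode (Proj i) = 6 * i + 2"
| "rencode (Comp f gs) = 6 * prod_encode (rencode f, list_encode (map rencode gs)) + 3"
| "rencode (PrimRec f g) = 6 * prod_encode (rencode f, rencode g) + 4"
| "rencode (Mu f) = 6 * rencode f + 5"

lemma rdecode_rencode [simp]: "rdecode (rencode t) = t"
proof (induction t)
  case (Comp f gs)
  then have "map (\<lambda>g. rdecode (rencode g)) gs = gs" by (simp add: map_idI)
  moreover have "(6 * m + 3) mod 6 = 3" "(6 * m + 3) div 6 = m" for m :: nat by presburger+
  ultimately show ?case using Comp by (subst rdecode.simps) (simp add: o_def Let_def)
next
  case (Proj i)
  have "(6 * m + 2) mod 6 = 2" "(6 * m + 2) div 6 = m" for m :: nat by presburger+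
  then show ?case by (subst rdecode.simps) (simp add: Let_def)
next
  case (PrimRec f g)
  have "(6 * m + 4) mod 6 = 4" "(6 * m + 4) div 6 = m" for m :: nat by presburger+
  then show ?case using PrimRec by (subst rdecode.simps) (simp add: Let_def)
next
  case (Mu f)
  have "(6 * m + 5) mod 6 = 5" "(6 * m + 5) div 6 = m" for m :: nat by presburger+
  then show ?case using Mu by (subst rdecode.simps) (simp add: Let_def)
qed (subst rdecode.simps, simp)+

text \<open>\<open>kapp n m\<close> is the application \<open>n m\<close> of the \<open>n\<close>-th (unary) partial recursive function to \<open>m\<close>.\<close>

definition kapp :: "nat \<Rightarrow> nat \<rightharpoonup> nat" where
  "kapp n m = reval (rdecode n) [m]"

definition partial_recursive :: "(nat \<rightharpoonup> nat) \<Rightarrow> bool" where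
  "partial_recursive \<phi> \<longleftrightarrow> (\<exists>t. \<forall>m. \<phi> m = reval t [m])"

lemma partial_recursive_iff_kapp: "partial_recursive \<phi> \<longleftrightarrow> (\<exists>n. \<phi> = kapp n)"
  unfolding partial_recursive_def kapp_def fun_eq_iff by (metis rdecode_rencode)


section \<open>The category of PERs\<close>

definition is_per :: "nat rel \<Rightarrow> bool" where
  "is_per R \<longleftrightarrow> sym R \<and> trans R"

definition per_dom :: "nat rel \<Rightarrow> nat set" where
  "per_dom R = {n. (n, n) \<in> R}"

text \<open>The set of classes \<open>dom R / R\<close>; the class of \<open>n\<close> is \<open>R `` {n}\<close>.\<close>

definition per_quot :: "nat rel \<Rightarrow> nat set set" where
  "per_quot R = per_dom R // R"

definition tracks :: "(nat \<rightharpoonup> nat) \<Rightarrow> nat rel \<Rightarrow> nat rel \<Rightarrow> (nat set \<Rightarrow> nat set) \<Rightarrow> bool" where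
  "tracks \<phi> R S f \<longleftrightarrow>
    (\<forall>n\<in>per_dom R. \<exists>m\<in>per_dom S. \<phi> n = Some m \<and> f (R `` {n}) = S `` {m})"

text \<open>Morphisms are extensional functions, so that equality of morphisms is equality in HOL.\<close>

definition per_hom :: "nat rel \<Rightarrow> nat rel \<Rightarrow> (nat set \<Rightarrow> nat set) set" where
  "per_hom R S =
    {f \<in> per_quot R \<rightarrow>\<^sub>E per_quot S. \<exists>\<phi>. partial_recursive \<phi> \<and> tracks \<phi> R S f}"

definition per_id :: "nat rel \<Rightarrow> nat set \<Rightarrow> nat set" where
  "per_id R = (\<lambda>c\<in>per_quot R. c)"

definition per_comp ::
  "nat rel \<Rightarrow> (nat set \<Rightarrow> nat set) \<Rightarrow> (nat set \<Rightarrow> nat set) \<Rightarrow> nat set \<Rightarrow> nat set" where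
  "per_comp R g f = compose (per_quot R) g f"

definition per_iso :: "nat rel \<Rightarrow> nat rel \<Rightarrow> (nat set \<Rightarrow> nat set) \<Rightarrow> bool" where
  "per_iso R S f \<longleftrightarrow> f \<in> per_hom R S \<and>
    (\<exists>g\<in>per_hom S R. per_comp R g f = per_id R \<and> per_comp S f g = per_id S)"

lemma per_id_in_hom: "per_id R \<in> per_hom R R"
proof -
  have "partial_recursive Some"
    unfolding partial_recursive_def by (rule exI[of _ "Proj 0"]) simp
  moreover have "tracks Some R R (per_id R)"
    by (auto simp: tracks_def per_id_def per_quot_def quotientI)
  moreover have "per_id R \<in> per_quot R \<rightarrow>\<^sub>E per_quot R"
    by (auto simp: per_id_def)
  ultimately show ?thesis unfolding per_hom_def by blast
qed

lemma per_comp_in_hom: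
  assumes "f \<in> per_hom R S" "g \<in> per_hom S T"
  shows "per_comp R g f \<in> per_hom R T"
proof -
  from assms obtain \<phi> \<psi> where
    f: "f \<in> per_quot R \<rightarrow>\<^sub>E per_quot S" "partial_recursive \<phi>" "tracks \<phi> R S f" and
    g: "g \<in> per_quot S \<rightarrow>\<^sub>E per_quot T" "partial_recursive \<psi>" "tracks \<psi> S T g"
    unfolding per_hom_def by blast
  from f(2) g(2) obtain s t where s: "\<And>m. \<phi> m = reval s [m]" and t: "\<And>m. \<psi> m = reval t [m]"
    unfolding partial_recursive_def by blast
  have "Option.bind (\<phi> m) \<psi> = reval (Comp t [s]) [m]" for m
    by (simp add: s[symmetric] t[symmetric] split: option.split)
  then have "partial_recursive (\<lambda>m. Option.bind (\<phi> m) \<psi>)"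
    unfolding partial_recursive_def by blast
  moreover have "tracks (\<lambda>m. Option.bind (\<phi> m) \<psi>) R T (per_comp R g f)"
    unfolding tracks_def
  proof
    fix n assume n: "n \<in> per_dom R"
    then obtain m where m: "m \<in> per_dom S" "\<phi> n = Some m" "f (R `` {n}) = S `` {m}"
      using f(3) unfolding tracks_def by blast
    then obtain l where "l \<in> per_dom T" "\<psi> m = Some l" "g (S `` {m}) = T `` {l}"
      using g(3) unfolding tracks_def by blast
    moreover have "R `` {n} \<in> per_quot R"
      using n by (simp add: per_quot_def quotientI)
    ultimately show "\<exists>l\<in>per_dom T. Option.bind (\<phi> n) \<psi> = Some l \<and>
        per_comp R g f (R `` {n}) = T `` {l}"
      using m by (auto simp: per_comp_def compose_def)
  qed
  moreover have "per_comp R g f \<in> per_quot R \<rightarrow>\<^sub>E per_quot T"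
    using f(1) g(1) by (auto simp: per_comp_def compose_def PiE_iff)
  ultimately show ?thesis unfolding per_hom_def by blast
qed


section \<open>Endofunctors\<close>

text \<open>The morphism map takes source and target as arguments: the same HOL function may be a
  morphism between several pairs of PERs.\<close>

record per_functor =
  obj :: "nat rel \<Rightarrow> nat rel"
  arr :: "nat rel \<Rightarrow> nat rel \<Rightarrow> (nat set \<Rightarrow> nat set) \<Rightarrow> nat set \<Rightarrow> nat set"

definition endofunctor :: "per_functor \<Rightarrow> bool" where
  "endofunctor F \<longleftrightarrow>
    (\<forall>R. is_per R \<longrightarrow> is_per (obj F R)) \<and>
    (\<forall>R S. is_per R \<longrightarrow> is_per S \<longrightarrow>
      (\<forall>f\<in>per_hom R S. arr F R S f \<in> per_hom (obj F R) (obj F S))) \<and>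
    (\<forall>R. is_per R \<longrightarrow> arr F R R (per_id R) = per_id (obj F R)) \<and>
    (\<forall>R S T. is_per R \<longrightarrow> is_per S \<longrightarrow> is_per T \<longrightarrow>
      (\<forall>f\<in>per_hom R S. \<forall>g\<in>per_hom S T.
        arr F R T (per_comp R g f) = per_comp (obj F R) (arr F S T g) (arr F R S f)))"

text \<open>\<open>[x]\<close> from \<open>R\<close> to \<open>S\<close> is the unique morphism \<open>f\<close> with \<open>tracks (kapp x) R S f\<close>.\<close>

definition realizable :: "per_functor \<Rightarrow> bool" where
  "realizable F \<longleftrightarrow>
    (\<exists>\<phi>. partial_recursive \<phi> \<and>
      (\<forall>R S x f. is_per R \<longrightarrow> is_per S \<longrightarrow> f \<in> per_hom R S \<longrightarrow> tracks (kapp x) R S f \<longrightarrow>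
        (\<exists>y. \<phi> x = Some y \<and> tracks (kapp y) (obj F R) (obj F S) (arr F R S f))))"

definition realizable_endofunctor :: "per_functor \<Rightarrow> bool" where
  "realizable_endofunctor F \<longleftrightarrow> endofunctor F \<and> realizable F"

definition monotone_functor :: "per_functor \<Rightarrow> bool" where
  "monotone_functor F \<longleftrightarrow>
    (\<forall>R S. is_per R \<longrightarrow> is_per S \<longrightarrow> R \<subseteq> S \<longrightarrow> obj F R \<subseteq> obj F S)"

definition naturally_isomorphic :: "per_functor \<Rightarrow> per_functor \<Rightarrow> bool" where
  "naturally_isomorphic F G \<longleftrightarrow>
    (\<exists>\<eta>. (\<forall>R. is_per R \<longrightarrow> per_iso (obj F R) (obj G R) (\<eta> R)) \<and>
      (\<forall>R S. is_per R \<longrightarrow> is_per S \<longrightarrow>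
        (\<forall>f\<in>per_hom R S.
          per_comp (obj F R) (\<eta> S) (arr F R S f) = per_comp (obj F R) (arr G R S f) (\<eta> R))))"

end

theory Submission
  imports Defs
begin

text \<open>Let \<open>e\<close> be the number to which the realizer of \<open>F\<close> sends an index of the identity function.
  For \<open>R \<subseteq> S\<close> it tracks the image under \<open>F\<close> of the inclusion of \<open>R\<close> in \<open>S\<close>, uniformly
  in \<open>R\<close> and \<open>S\<close>. Put
  \<open>G R = {(n, m). (e n, e m) \<in> F S for all S \<supseteq> R}\<close>, which is visibly monotone in \<open>R\<close>. Then
  \<open>F R \<subseteq> G R\<close>, and \<open>e\<close> tracks an inverse of this inclusion, because \<open>e\<close> tracks the identity on each
  \<open>F S\<close>. Transporting \<open>F\<close> along these isomorphisms makes \<open>G\<close> a functor, and it is realizable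
  because an index of \<open>n \<mapsto> (\<phi> x) (e n)\<close> can be computed from \<open>x\<close>.\<close>

section \<open>Morphisms and their trackers\<close>

lemma per_class_eq_iff:
  assumes "is_per R" "m \<in> per_dom R" "n \<in> per_dom R"
  shows "R `` {m} = R `` {n} \<longleftrightarrow> (m, n) \<in> R"
  using assms unfolding is_per_def per_dom_def sym_def trans_def by blast

lemma per_dom_of_related:
  assumes "is_per R" "(m, n) \<in> R"
  shows "m \<in> per_dom R" "n \<in> per_dom R"
  using assms unfolding is_per_def per_dom_def sym_def trans_def by blast+

lemma per_class_in_quot: "n \<in> per_dom R \<Longrightarrow> R `` {n} \<in> per_quot R"
  by (simp add: per_quot_def quotientI)

lemma per_quotE:
  assumes "c \<in> per_quot R"
  obtains n where "n \<in> per_dom R" "c = R `` {n}"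
  using assms unfolding per_quot_def by (rule quotientE)

lemma per_hom_PiE: "f \<in> per_hom R S \<Longrightarrow> f \<in> per_quot R \<rightarrow>\<^sub>E per_quot S"
  by (simp add: per_hom_def)

lemma per_hom_eqI:
  assumes "f \<in> per_hom R S" "g \<in> per_hom R S"
    and "\<And>n. n \<in> per_dom R \<Longrightarrow> f (R `` {n}) = g (R `` {n})"
  shows "f = g"
  using per_hom_PiE[OF assms(1)] per_hom_PiE[OF assms(2)]
  by (rule PiE_ext) (metis assms(3) per_quotE)

lemma tracks_related:
  assumes "is_per R" "is_per S" "tracks \<phi> R S f" "(n, m) \<in> R"
  shows "\<exists>a b. \<phi> n = Some a \<and> \<phi> m = Some b \<and> (a, b) \<in> S"
proof -
  note nm = per_dom_of_related[OF assms(1,4)]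
  obtain a b where "a \<in> per_dom S" "\<phi> n = Some a" "f (R `` {n}) = S `` {a}"
    and "b \<in> per_dom S" "\<phi> m = Some b" "f (R `` {m}) = S `` {b}"
    using assms(3) nm unfolding tracks_def by blast
  moreover have "R `` {n} = R `` {m}"
    using per_class_eq_iff[OF assms(1) nm] assms(4) by simp
  ultimately show ?thesis
    using per_class_eq_iff[OF assms(2)] by metis
qed

text \<open>Converse to \<open>tracks_related\<close>: the relational hypothesis is exactly
  well-definedness on classes. The inclusions of PERs and both directions of the natural isomorphism
  are obtained from it.\<close>

lemma tracked_morphism_exists:
  assumes R: "is_per R" and S: "is_per S" and "partial_recursive \<phi>"
    and rel: "\<And>n m. (n, m) \<in> R \<Longrightarrow> \<exists>a b. \<phi> n = Some a \<and> \<phi> m = Some b \<and> (a, b) \<in> S"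
  shows "\<exists>f\<in>per_hom R S. tracks \<phi> R S f"
proof -
  \<comment> \<open>The value on a class is read off from a chosen representative;
    \<open>rel\<close> makes the choice immaterial. The restriction to \<open>per_quot R\<close>
    supplies the extensionality that \<open>per_hom\<close> demands.\<close>
  define f where "f = (\<lambda>c\<in>per_quot R. S `` {the (\<phi> (SOME n. n \<in> c))})"
  have tr: "tracks \<phi> R S f"
    unfolding tracks_def
  proof
    fix n assume n: "n \<in> per_dom R"
    then have "n \<in> R `` {n}" by (simp add: per_dom_def)
    then have "(SOME m. m \<in> R `` {n}) \<in> R `` {n}" by (rule someI)
    then obtain a b where ab: "\<phi> n = Some a" "\<phi> (SOME m. m \<in> R `` {n}) = Some b" "(a, b) \<in> S"
      using rel by blast
    note dom = per_dom_of_related[OF S ab(3)]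
    have "f (R `` {n}) = S `` {b}"
      using per_class_in_quot[OF n] ab(2) by (simp add: f_def)
    also have "\<dots> = S `` {a}"
      using per_class_eq_iff[OF S dom] ab(3) by simp
    finally show "\<exists>m\<in>per_dom S. \<phi> n = Some m \<and> f (R `` {n}) = S `` {m}"
      using ab(1) dom(1) by blast
  qed
  have "f c \<in> per_quot S" if c: "c \<in> per_quot R" for c
  proof -
    obtain n where "n \<in> per_dom R" "c = R `` {n}" using c by (rule per_quotE)
    then show ?thesis using tr unfolding tracks_def by (metis per_class_in_quot)
  qed
  then have "f \<in> per_quot R \<rightarrow>\<^sub>E per_quot S"
    by (auto simp: f_def)
  with tr assms(3) show ?thesis unfolding per_hom_def by blast
qed

lemma per_comp_class:
  "n \<in> per_dom R \<Longrightarrow> per_comp R g f (R `` {n}) = g (f (R `` {n}))"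
  by (simp add: per_comp_def compose_def per_class_in_quot)

lemma per_id_class: "n \<in> per_dom R \<Longrightarrow> per_id R (R `` {n}) = R `` {n}"
  by (simp add: per_id_def per_class_in_quot)

lemma tracks_per_comp:
  assumes "tracks \<phi> R S f" "tracks \<psi> S T g"
  shows "tracks (\<lambda>n. Option.bind (\<phi> n) \<psi>) R T (per_comp R g f)"
  unfolding tracks_def
proof
  fix n assume n: "n \<in> per_dom R"
  then obtain m where m: "m \<in> per_dom S" "\<phi> n = Some m" "f (R `` {n}) = S `` {m}"
    using assms(1) unfolding tracks_def by blast
  then obtain l where "l \<in> per_dom T" "\<psi> m = Some l" "g (S `` {m}) = T `` {l}"
    using assms(2) unfolding tracks_def by blast
  then show "\<exists>l\<in>per_dom T. Option.bind (\<phi> n) \<psi> = Some l \<and> per_comp R g f (R `` {n}) = T `` {l}"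
    using m n by (auto simp: per_comp_class)
qed

text \<open>The composite is tracked by \<open>\<phi>\<close> followed by \<open>\<psi>\<close>, so
  it sends the class of \<open>n\<close> to the class of a number related to \<open>n\<close>, which
  is the same class.\<close>

lemma per_comp_eq_idI:
  assumes R: "is_per R" and f: "f \<in> per_hom R S" "tracks \<phi> R S f"
    and g: "g \<in> per_hom S R" "tracks \<psi> S R g"
    and rel: "\<And>n. n \<in> per_dom R \<Longrightarrow> \<exists>m. Option.bind (\<phi> n) \<psi> = Some m \<and> (n, m) \<in> R"
  shows "per_comp R g f = per_id R"
proof (rule per_hom_eqI)
  show "per_comp R g f \<in> per_hom R R" using f(1) g(1) by (rule per_comp_in_hom)
  show "per_id R \<in> per_hom R R" by (rule per_id_in_hom)
  fix n assume n: "n \<in> per_dom R"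
  obtain m where m: "m \<in> per_dom R" "Option.bind (\<phi> n) \<psi> = Some m"
      "per_comp R g f (R `` {n}) = R `` {m}"
    using tracks_per_comp[OF f(2) g(2)] n unfolding tracks_def by blast
  then have "(n, m) \<in> R" using rel[OF n] by auto
  then show "per_comp R g f (R `` {n}) = per_id R (R `` {n})"
    using per_class_eq_iff[OF R n m(1)] m(3) per_id_class[OF n] by simp
qed

text \<open>The inner restriction to \<open>per_quot S\<close> does no harm because \<open>f\<close>
  maps \<open>per_quot R\<close> into \<open>per_quot S\<close>.\<close>

lemma per_comp_assoc:
  assumes "f \<in> per_hom R S"
  shows "per_comp R (per_comp S h g) f = per_comp R h (per_comp R g f)"
  using per_hom_PiE[OF assms] unfolding per_comp_def compose_def by (auto simp: fun_eq_iff)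

lemma per_comp_id_right: "f \<in> per_hom R S \<Longrightarrow> per_comp R f (per_id R) = f"
  by (rule per_hom_eqI[OF per_comp_in_hom[OF per_id_in_hom]])
     (auto simp: per_comp_class per_id_class)

lemma per_comp_id_left:
  assumes "f \<in> per_hom R S"
  shows "per_comp R (per_id S) f = f"
  using per_hom_PiE[OF assms] unfolding per_comp_def compose_def per_id_def
  by (auto simp: fun_eq_iff)

section \<open>Transport of a functor along isomorphisms of its objects\<close>

definition transport ::
  "per_functor \<Rightarrow> (nat rel \<Rightarrow> nat rel) \<Rightarrow> (nat rel \<Rightarrow> nat set \<Rightarrow> nat set) \<Rightarrow>
    (nat rel \<Rightarrow> nat set \<Rightarrow> nat set) \<Rightarrow> per_functor" where
  "transport F G \<eta> \<theta> =
    \<lparr>obj = G, arr = (\<lambda>R S f. per_comp (G R) (per_comp (obj F R) (\<eta> S) (arr F R S f)) (\<theta> R))\<rparr>"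

text \<open>Arrows are conjugated by isomorphisms, so in a composite the inner pair
  \<open>\<theta> S\<close>, \<open>\<eta> S\<close> cancels and the functor laws reduce to those of
  \<open>F\<close>.\<close>

lemma transport_endofunctor_and_iso:
  assumes F: "endofunctor F"
    and G: "\<And>R. is_per R \<Longrightarrow> is_per (G R)"
    and \<eta>: "\<And>R. is_per R \<Longrightarrow> \<eta> R \<in> per_hom (obj F R) (G R)"
    and \<theta>: "\<And>R. is_per R \<Longrightarrow> \<theta> R \<in> per_hom (G R) (obj F R)"
    and \<theta>\<eta>: "\<And>R. is_per R \<Longrightarrow> per_comp (obj F R) (\<theta> R) (\<eta> R) = per_id (obj F R)"
    and \<eta>\<theta>: "\<And>R. is_per R \<Longrightarrow> per_comp (G R) (\<eta> R) (\<theta> R) = per_id (G R)"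
  shows "endofunctor (transport F G \<eta> \<theta>)" "naturally_isomorphic F (transport F G \<eta> \<theta>)"
proof -
  have F_hom: "arr F R S f \<in> per_hom (obj F R) (obj F S)"
    if "is_per R" "is_per S" "f \<in> per_hom R S" for R S f
    using F that unfolding endofunctor_def by blast
  have F_id: "arr F R R (per_id R) = per_id (obj F R)" if "is_per R" for R
    using F that unfolding endofunctor_def by blast
  have F_comp: "arr F R T (per_comp R g f) = per_comp (obj F R) (arr F S T g) (arr F R S f)"
    if "is_per R" "is_per S" "is_per T" "f \<in> per_hom R S" "g \<in> per_hom S T" for R S T f g
    using F that unfolding endofunctor_def by blast
  have \<eta>F_hom: "per_comp (obj F R) (\<eta> S) (arr F R S f) \<in> per_hom (obj F R) (G S)"
    if "is_per R" "is_per S" "f \<in> per_hom R S" for R S f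
    using per_comp_in_hom[OF F_hom[OF that] \<eta>[OF that(2)]] .
  define A where "A = (\<lambda>R S f. per_comp (G R) (per_comp (obj F R) (\<eta> S) (arr F R S f)) (\<theta> R))"
  have A_hom: "A R S f \<in> per_hom (G R) (G S)"
    if "is_per R" "is_per S" "f \<in> per_hom R S" for R S f
    using per_comp_in_hom[OF \<theta>[OF that(1)] \<eta>F_hom[OF that]] unfolding A_def .
  \<comment> \<open>This is the naturality square of \<open>\<eta>\<close>; it also provides the
    cancellation in \<open>A_comp\<close>.\<close>
  have A_\<eta>: "per_comp (obj F R) (A R S f) (\<eta> R) = per_comp (obj F R) (\<eta> S) (arr F R S f)"
    if "is_per R" "is_per S" "f \<in> per_hom R S" for R S f
    unfolding A_def per_comp_assoc[OF \<eta>[OF that(1)]] \<theta>\<eta>[OF that(1)]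
    by (rule per_comp_id_right[OF \<eta>F_hom[OF that]])
  have A_id: "A R R (per_id R) = per_id (G R)" if "is_per R" for R
    unfolding A_def F_id[OF that] per_comp_id_right[OF \<eta>[OF that]] by (rule \<eta>\<theta>[OF that])
  have A_comp: "A R T (per_comp R g f) = per_comp (G R) (A S T g) (A R S f)"
    if RST: "is_per R" "is_per S" "is_per T" and f: "f \<in> per_hom R S" and g: "g \<in> per_hom S T"
    for R S T f g
  proof -
    have "per_comp (G R) (A S T g) (A R S f) =
        per_comp (G R) (per_comp (obj F R) (A S T g) (per_comp (obj F R) (\<eta> S) (arr F R S f))) (\<theta> R)"
      \<comment> \<open>The instantiated equation expands only the right factor; the arrow of
        \<open>g\<close> stays folded so that \<open>A_\<eta>\<close> applies to it.\<close>
      unfolding fun_cong[OF fun_cong[OF fun_cong[OF A_def]], of R S f]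
      by (simp add: per_comp_assoc[OF \<theta>[OF RST(1)]])
    also have "per_comp (obj F R) (A S T g) (per_comp (obj F R) (\<eta> S) (arr F R S f)) =
        per_comp (obj F R) (per_comp (obj F S) (\<eta> T) (arr F S T g)) (arr F R S f)"
      by (simp add: per_comp_assoc[OF F_hom[OF RST(1,2) f], symmetric] A_\<eta>[OF RST(2,3) g])
    also have "\<dots> = per_comp (obj F R) (\<eta> T) (arr F R T (per_comp R g f))"
      by (simp add: per_comp_assoc[OF F_hom[OF RST(1,2) f]] F_comp[OF RST f g])
    finally show ?thesis by (simp add: A_def)
  qed
  have transport_eq: "transport F G \<eta> \<theta> = \<lparr>obj = G, arr = A\<rparr>"
    by (simp add: transport_def A_def)
  show "endofunctor (transport F G \<eta> \<theta>)"
    unfolding endofunctor_def transport_eq by (simp add: G A_hom A_id A_comp)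
  show "naturally_isomorphic F (transport F G \<eta> \<theta>)"
    unfolding naturally_isomorphic_def transport_eq
    by (rule exI[of _ \<eta>]) (use \<eta> \<theta> \<theta>\<eta> \<eta>\<theta> A_\<eta> in \<open>auto simp: per_iso_def intro!: bexI[of _ "\<theta> _"]\<close>)
qed

section \<open>Computing an index of a composite\<close>

text \<open>Residue 3 marks \<open>Comp\<close>, and \<open>list_encode [b]\<close> codes its
  one-element argument list. An index of a composite is thus explicit arithmetic in the two indices,
  which takes the place of the s-m-n theorem.\<close>

lemma kapp_Comp_code:
  "kapp (6 * prod_encode (a, list_encode [b]) + 3) n = Option.bind (kapp b n) (kapp a)"
proof -
  have "(6 * m + 3) mod 6 = 3" "(6 * m + 3) div 6 = m" for m :: nat by presburger+
  then have "rdecode (6 * prod_encode (a, list_encode [b]) + 3) = Comp (rdecode a) [rdecode b]"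
    by (subst rdecode.simps) (simp add: Let_def del: list_encode.simps)
  then show ?thesis
    by (simp add: kapp_def split: option.split)
qed

lemma partial_recursive_bind:
  assumes "partial_recursive \<phi>" "partial_recursive \<psi>"
  shows "partial_recursive (\<lambda>n. Option.bind (\<phi> n) \<psi>)"
proof -
  from assms obtain a b where "\<phi> = kapp b" "\<psi> = kapp a"
    unfolding partial_recursive_iff_kapp by blast
  then have "(\<lambda>n. Option.bind (\<phi> n) \<psi>) = kapp (6 * prod_encode (a, list_encode [b]) + 3)"
    by (intro ext) (simp only: kapp_Comp_code)
  then show ?thesis unfolding partial_recursive_iff_kapp by blast
qed

lemma partial_recursive_Some: "partial_recursive Some"
  unfolding partial_recursive_def by (rule exI[of _ "Proj 0"]) simp

lemma partial_recursive_const: "partial_recursive (\<lambda>_. Some c)"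
proof (induction c)
  case 0
  show ?case unfolding partial_recursive_def by (rule exI[of _ Zero]) simp
next
  case (Suc c)
  then obtain t where "\<And>m. Some c = reval t [m]" unfolding partial_recursive_def by blast
  then have "Some (Suc c) = reval (Comp Succ [t]) [m]" for m by (simp flip: \<open>\<And>m. Some c = _\<close>)
  then show ?case unfolding partial_recursive_def by blast
qed

text \<open>Recursion on \<open>m\<close>: the step term receives counter, previous value and
  parameter in this order, so \<open>Proj 1\<close> is the previous value, while in the base term
  \<open>Proj 0\<close> is \<open>n\<close>.\<close>

lemma reval_add: "reval (PrimRec (Proj 0) (Comp Succ [Proj 1])) [m, n] = Some (m + n)"
proof -
  have "rec_nat (Some n) (\<lambda>k r. Option.bind r (\<lambda>v. Some (Suc v))) m = Some (m + n)"
    by (induction m) auto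
  then show ?thesis by simp
qed

lemma partial_recursive_add:
  assumes "partial_recursive (\<lambda>x. Some (f x))" "partial_recursive (\<lambda>x. Some (g x))"
  shows "partial_recursive (\<lambda>x. Some (f x + g x))"
proof -
  from assms obtain s t where s: "\<And>x. reval s [x] = Some (f x)" and t: "\<And>x. reval t [x] = Some (g x)"
    unfolding partial_recursive_def by metis
  have "reval (Comp (PrimRec (Proj 0) (Comp Succ [Proj 1])) [s, t]) [x] = Some (f x + g x)" for x
    by (subst reval.simps(4)) (simp add: s t reval_add del: reval.simps One_nat_def)
  then show ?thesis unfolding partial_recursive_def by metis
qed

text \<open>The pairing is \<open>prod_encode (a, c) = triangle (a + c) + a\<close>, so its
  computability rests on this. The step term turns counter \<open>k\<close> and value
  \<open>v\<close> into \<open>Suc (k + v)\<close>, the recursion equation of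
  \<open>triangle\<close>.\<close>

lemma partial_recursive_triangle: "partial_recursive (\<lambda>x. Some (triangle x))"
proof -
  define add where "add = PrimRec (Proj 0) (Comp Succ [Proj 1])"
  define step where "step = Comp Succ [Comp add [Proj 0, Proj 1]]"
  have "reval step [k, v] = Some (Suc (k + v))" for k v
    using reval_add unfolding add_def[symmetric] by (simp add: step_def)
  then have "reval (PrimRec Zero step) [x] = Some (triangle x)" for x
    by (induction x) (simp_all add: triangle_Suc)
  then show ?thesis unfolding partial_recursive_def by metis
qed

text \<open>The inner function of the composite is fixed through \<open>c\<close>, so it suffices
  that a unary map computes the code from the outer index.\<close>

lemma partial_recursive_Comp_code:
  "partial_recursive (\<lambda>a. Some (6 * prod_encode (a, c) + 3))"
proof -
  have add_c: "partial_recursive (\<lambda>a. Some (a + c))"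
    by (rule partial_recursive_add) (simp_all add: partial_recursive_Some partial_recursive_const)
  have "partial_recursive (\<lambda>a. Some (triangle (a + c)))"
    using partial_recursive_bind[OF add_c partial_recursive_triangle] by simp
  then have enc: "partial_recursive (\<lambda>a. Some (prod_encode (a, c)))"
    unfolding prod_encode_def
    using partial_recursive_add[OF _ partial_recursive_Some] by simp
  \<comment> \<open>Multiplication by a constant is repeated addition; the factor 6 is generalised
    to \<open>k\<close> for the induction.\<close>
  have "partial_recursive (\<lambda>a. Some (k * prod_encode (a, c) + 3))" for k
  proof (induction k)
    case 0
    show ?case using partial_recursive_const by simp
  next
    case (Suc k)
    then show ?case using partial_recursive_add[OF enc Suc] by (simp add: add.assoc)
  qed
  then show ?thesis .
qed

section \<open>The monotone functor\<close>

lemma partial_recursive_kapp: "partial_recursive (kapp n)"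
  unfolding partial_recursive_iff_kapp by blast

definition saturation :: "(nat rel \<Rightarrow> nat rel) \<Rightarrow> nat \<Rightarrow> nat rel \<Rightarrow> nat rel" where
  "saturation F e R = {(n, m). \<forall>S. is_per S \<longrightarrow> R \<subseteq> S \<longrightarrow>
    (\<exists>a b. kapp e n = Some a \<and> kapp e m = Some b \<and> (a, b) \<in> F S)}"

lemma saturation_mono: "R \<subseteq> S \<Longrightarrow> saturation F e R \<subseteq> saturation F e S"
  unfolding saturation_def by blast

text \<open>An intersection of inverse images of PERs under the partial function
  \<open>kapp e\<close>. Transitivity uses that \<open>kapp e\<close> has only one value at the
  middle element.\<close>

lemma saturation_is_per:
  assumes "\<And>S. is_per S \<Longrightarrow> is_per (F S)"
  shows "is_per (saturation F e R)"
proof -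
  have F: "(b, a) \<in> F S" if "is_per S" "(a, b) \<in> F S" for a b S
    using assms[OF that(1)] that(2) unfolding is_per_def by (blast dest: symD)
  have F': "(a, c) \<in> F S" if "is_per S" "(a, b) \<in> F S" "(b, c) \<in> F S" for a b c S
    using assms[OF that(1)] that(2,3) unfolding is_per_def by (blast dest: transD)
  have "sym (saturation F e R)"
    unfolding sym_def saturation_def using F by blast
  moreover have "trans (saturation F e R)"
  proof (rule transI)
    fix x y z assume xy: "(x, y) \<in> saturation F e R" and yz: "(y, z) \<in> saturation F e R"
    have "\<exists>a b. kapp e x = Some a \<and> kapp e z = Some b \<and> (a, b) \<in> F S"
      if S: "is_per S" "R \<subseteq> S" for S
    proof -
      obtain a b b' c where "kapp e x = Some a" "kapp e y = Some b" "(a, b) \<in> F S"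
        and "kapp e y = Some b'" "kapp e z = Some c" "(b', c) \<in> F S"
        using xy yz S unfolding saturation_def by blast
      then show ?thesis using F'[OF S(1)] by auto
    qed
    then show "(x, z) \<in> saturation F e R" unfolding saturation_def by blast
  qed
  ultimately show ?thesis by (simp add: is_per_def)
qed

theorem mainTheorem3:
  fixes F :: per_functor
  assumes "realizable_endofunctor F"
  shows "\<exists>G. realizable_endofunctor G \<and> monotone_functor G \<and> naturally_isomorphic F G"
proof -
  have F: "endofunctor F" using assms by (simp add: realizable_endofunctor_def)
  then have obj_per: "is_per (obj F R)" if "is_per R" for R
    using that unfolding endofunctor_def by blast
  obtain \<phi> where \<phi>: "partial_recursive \<phi>"
    and \<phi>_tracks: "\<And>R S x f. is_per R \<Longrightarrow> is_per S \<Longrightarrow> f \<in> per_hom R S \<Longrightarrow>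
      tracks (kapp x) R S f \<Longrightarrow>
      \<exists>y. \<phi> x = Some y \<and> tracks (kapp y) (obj F R) (obj F S) (arr F R S f)"
    using assms unfolding realizable_endofunctor_def realizable_def by blast

  \<comment> \<open>The uniform index \<open>e\<close>\<close>
  obtain i where i: "kapp i = Some"
    using partial_recursive_Some unfolding partial_recursive_iff_kapp by metis
  have i_id: "tracks (kapp i) R R (per_id R)" for R
    by (auto simp: tracks_def i per_id_class)
  \<comment> \<open>Any PER would do here: \<open>\<phi> i\<close> does not mention the PERs, so one
    instance already yields the \<open>e\<close> that serves all of them.\<close>
  have "is_per {}" by (simp add: is_per_def sym_def trans_def)
  then obtain e where e: "\<phi> i = Some e"
    using \<phi>_tracks[OF _ _ per_id_in_hom i_id] by blast
  have e_incl: "\<exists>a b. kapp e n = Some a \<and> kapp e m = Some b \<and> (a, b) \<in> obj F S"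
    if R: "is_per R" and S: "is_per S" and "R \<subseteq> S" and nm: "(n, m) \<in> obj F R" for R S n m
  proof -
    obtain f where f: "f \<in> per_hom R S" "tracks Some R S f"
      using tracked_morphism_exists[OF R S partial_recursive_Some] \<open>R \<subseteq> S\<close> by blast
    then have "tracks (kapp e) (obj F R) (obj F S) (arr F R S f)"
      using \<phi>_tracks[OF R S f(1), of i] e by (simp add: i)
    then show ?thesis by (rule tracks_related[OF obj_per[OF R] obj_per[OF S] _ nm])
  qed
  have e_id: "\<exists>m. kapp e n = Some m \<and> (n, m) \<in> obj F R"
    if R: "is_per R" and n: "n \<in> per_dom (obj F R)" for R n
  proof -
    have "arr F R R (per_id R) = per_id (obj F R)"
      using F R unfolding endofunctor_def by blast
    then have "tracks (kapp e) (obj F R) (obj F R) (per_id (obj F R))"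
      using \<phi>_tracks[OF R R per_id_in_hom i_id] e by simp
    then obtain m where "m \<in> per_dom (obj F R)" "kapp e n = Some m"
        "per_id (obj F R) (obj F R `` {n}) = obj F R `` {m}"
      using n unfolding tracks_def by blast
    then show ?thesis
      using per_class_eq_iff[OF obj_per[OF R] n] by (simp add: per_id_class[OF n])
  qed

  \<comment> \<open>The PERs \<open>G R\<close> and their comparison with
    \<open>obj F R\<close>\<close>
  define G where "G = saturation (obj F) e"
  have G_per: "is_per (G R)" for R
    unfolding G_def using obj_per by (rule saturation_is_per)
  have incl: "(n, m) \<in> G R" if "is_per R" "(n, m) \<in> obj F R" for R n m
    using e_incl[OF that(1) _ _ that(2)] unfolding G_def saturation_def by blast
  \<comment> \<open>The case \<open>S = R\<close> of the quantifier in
    \<open>saturation\<close>.\<close>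
  have retr: "\<exists>a b. kapp e n = Some a \<and> kapp e m = Some b \<and> (a, b) \<in> obj F R"
    if "is_per R" "(n, m) \<in> G R" for R n m
    using that unfolding G_def saturation_def by blast
  have e_G_id: "\<exists>m. kapp e n = Some m \<and> (n, m) \<in> G R"
    if R: "is_per R" and n: "n \<in> per_dom (G R)" for R n
  proof -
    have nn: "(n, n) \<in> G R" using n by (simp add: per_dom_def)
    then obtain m where m: "kapp e n = Some m"
      using retr[OF R] by blast
    \<comment> \<open>Membership of \<open>(n, n)\<close> in \<open>G R\<close> puts
      \<open>m\<close> into the domain of every \<open>obj F S\<close>, where \<open>kapp e\<close>
      moves it only within its class. Since \<open>m\<close> is the value of \<open>kapp e\<close>
      at \<open>n\<close>, this says that \<open>(n, m)\<close> lies in \<open>G R\<close>.\<close>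
    have "\<exists>b. kapp e m = Some b \<and> (m, b) \<in> obj F S" if S: "is_per S" "R \<subseteq> S" for S
    proof (rule e_id[OF S(1)])
      show "m \<in> per_dom (obj F S)"
        using nn S m unfolding G_def saturation_def by (auto simp: per_dom_def)
    qed
    then show ?thesis using m unfolding G_def saturation_def by auto
  qed

  \<comment> \<open>The mutually inverse morphisms \<open>\<eta> R\<close> and
    \<open>\<theta> R\<close>\<close>
  have "\<exists>f. f \<in> per_hom (obj F R) (G R) \<and> tracks Some (obj F R) (G R) f" if "is_per R" for R
    using tracked_morphism_exists[OF obj_per[OF that] G_per partial_recursive_Some] incl[OF that]
    by blast
  then obtain \<eta> where \<eta>: "\<And>R. is_per R \<Longrightarrow> \<eta> R \<in> per_hom (obj F R) (G R)"
    and \<eta>_tracks: "\<And>R. is_per R \<Longrightarrow> tracks Some (obj F R) (G R) (\<eta> R)"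
    by metis
  have "\<exists>f. f \<in> per_hom (G R) (obj F R) \<and> tracks (kapp e) (G R) (obj F R) f" if "is_per R" for R
    using tracked_morphism_exists[OF G_per obj_per[OF that] partial_recursive_kapp retr[OF that]]
    by blast
  then obtain \<theta> where \<theta>: "\<And>R. is_per R \<Longrightarrow> \<theta> R \<in> per_hom (G R) (obj F R)"
    and \<theta>_tracks: "\<And>R. is_per R \<Longrightarrow> tracks (kapp e) (G R) (obj F R) (\<theta> R)"
    by metis
  \<comment> \<open>Both composites act on representatives as \<open>kapp e\<close>, so the two
    identities come down to \<open>e_id\<close> on \<open>obj F R\<close> and \<open>e_G_id\<close>
    on \<open>G R\<close>.\<close>
  have \<theta>\<eta>: "per_comp (obj F R) (\<theta> R) (\<eta> R) = per_id (obj F R)" if R: "is_per R" for R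
    by (rule per_comp_eq_idI[OF obj_per[OF R] \<eta>[OF R] \<eta>_tracks[OF R] \<theta>[OF R] \<theta>_tracks[OF R]])
       (simp add: e_id[OF R])
  have \<eta>\<theta>: "per_comp (G R) (\<eta> R) (\<theta> R) = per_id (G R)" if R: "is_per R" for R
    by (rule per_comp_eq_idI[OF G_per \<theta>[OF R] \<theta>_tracks[OF R] \<eta>[OF R] \<eta>_tracks[OF R]])
       (use e_G_id[OF R] in auto)

  \<comment> \<open>The transported functor and its realizer\<close>
  define H where "H = transport F G \<eta> \<theta>"
  have H: "endofunctor H" "naturally_isomorphic F H"
    unfolding H_def using transport_endofunctor_and_iso[OF F G_per \<eta> \<theta> \<theta>\<eta> \<eta>\<theta>] by blast+
  have mono: "monotone_functor H"
    unfolding monotone_functor_def H_def transport_def G_def by (simp add: saturation_mono)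
  \<comment> \<open>An arrow of \<open>H\<close> is \<open>\<theta> R\<close>, then the arrow of
    \<open>F\<close>, then \<open>\<eta> S\<close>, tracked by \<open>kapp e\<close>,
    \<open>kapp y\<close> and the identity. The code is that of \<open>kapp y\<close> after
    \<open>kapp e\<close>, and it does not depend on \<open>R\<close> and \<open>S\<close>.\<close>
  define \<psi> where
    "\<psi> = (\<lambda>x. Option.bind (\<phi> x) (\<lambda>y. Some (6 * prod_encode (y, list_encode [e]) + 3)))"
  have "realizable H"
    unfolding realizable_def
  proof (intro exI[of _ \<psi>] conjI allI impI)
    show "partial_recursive \<psi>"
      unfolding \<psi>_def by (rule partial_recursive_bind[OF \<phi> partial_recursive_Comp_code])
    fix R S x f
    assume R: "is_per R" and S: "is_per S" and f: "f \<in> per_hom R S" "tracks (kapp x) R S f"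
    obtain y where y: "\<phi> x = Some y" "tracks (kapp y) (obj F R) (obj F S) (arr F R S f)"
      using \<phi>_tracks[OF R S f] by blast
    let ?z = "6 * prod_encode (y, list_encode [e]) + 3"
    have z: "kapp ?z = (\<lambda>n. Option.bind (kapp e n) (kapp y))"
      using kapp_Comp_code by blast
    have "tracks (kapp ?z) (G R) (G S) (arr H R S f)"
      \<comment> \<open>The final bind with \<open>Some\<close>, coming from
        \<open>\<eta> S\<close>, disappears by simplification.\<close>
      using tracks_per_comp[OF \<theta>_tracks[OF R] tracks_per_comp[OF y(2) \<eta>_tracks[OF S]]]
      unfolding z H_def transport_def by (simp del: list_encode.simps)
    moreover have "\<psi> x = Some ?z" by (simp add: \<psi>_def y(1))
    moreover have "obj H = G" by (simp add: H_def transport_def)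
    ultimately show "\<exists>z. \<psi> x = Some z \<and> tracks (kapp z) (obj H R) (obj H S) (arr H R S f)"
      by auto
  qed
  then show ?thesis using H mono unfolding realizable_endofunctor_def by blast
qed

end
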